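(* Let $Q^T\tau$ be a system of pairwise comparisons of $v$ treatments with $r=\mathrm{rank}(Q)$, let $w>0$ be a feasible design and let $G$ be the corresponding vertex-weighted graph. Let $d_i$ be the degree of vertex $i$ in $G$ and let $\tilde d_i=w_i^{-1}d_i$ be its weighted degree. Then $\Psi_{-1}(w)=\sum_i w_i^{-1}d_i=\sum_i\tilde d_i$ and $\Phi_{-1}(w)=r\big(\sum_i w_i^{-1}d_i\big)^{-1}$.
   Context: A system of $s$ pairwise comparisons $Q^T\tau$ is given by a $v\times s$ matrix $Q$ every column of which represents a difference $\tau_j-\tau_i$ with $i\ne j$ (entry $1$ in row $j$, $-1$ in row $i$, zeros elsewhere), different columns corresponding to different unordered pairs $\{i,j\}$; no row of $Q$ is zero. The corresponding graph $G$ has vertex set $\{1,\ldots,v\}$, an edge $(j,i)$ for each comparison $\tau_j-\tau_i$ in the system, and vertex weights $\alpha_i=w_i^{-1}$; $d_i$ is the number of edges incident with $i$. A design is $w$ with $w_i\in[0,1]$, $\sum_iw_i=1$; it is feasible if and only if $w_i>0$ for all $i$. $V_Q(w)=Q^T\mathrm{diag}(w)^{-1}Q$, eigenvalues are ordered decreasingly, $\Psi_{-1}(w)=\sum_{j=1}^r\lambda_j(V_Q(w))=\mathrm{tr}(V_Q(w))$, and $\Phi_{-1}(w)=\big(\frac1r\sum_{j=1}^r\lambda_j^{-1}(C_Q(w))\big)^{-1}$, where $C_Q(w)=V_Q(w)^+$ is the Moore-Penrose pseudoinverse (equal to $V_Q(w)^{-1}$ when $Q$ has full column rank). *)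

theory Defs
  imports "HOL-Analysis.Analysis" "HOL-Computational_Algebra.Polynomial"
begin

text \<open>
  Treatments are indexed by \<open>'v\<close>, comparisons by \<open>'s\<close>.
\<close>

definition comparison :: "'v \<Rightarrow> 'v \<Rightarrow> real ^ 'v::finite" where
  "comparison j i = axis j 1 - axis i 1"

text \<open>
  The support of a column representing \<open>\<tau>\<^sub>j - \<tau>\<^sub>i\<close> is the unordered pair \<open>{i, j}\<close>, so the
  injectivity condition says that different columns compare different unordered pairs.
\<close>

definition pairwise_comparisons :: "real ^ 's ^ 'v \<Rightarrow> bool" where
  "pairwise_comparisons Q \<longleftrightarrow>
     (\<forall>k. \<exists>i j. i \<noteq> j \<and> column k Q = comparison j i) \<and>
     inj (\<lambda>k. {i. column k Q $ i \<noteq> 0}) \<and>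
     (\<forall>i. row i Q \<noteq> 0)"

text \<open>
  The graph has vertex set \<open>UNIV :: 'v set\<close>, so it is given by its edge set; the orientation of
  the comparisons plays no role in it.
\<close>

definition comparison_graph :: "real ^ 's ^ 'v \<Rightarrow> 'v set set" where
  "comparison_graph Q = {{j, i} | j i. \<exists>k. column k Q = comparison j i}"

definition degree_of :: "'v set set \<Rightarrow> 'v \<Rightarrow> nat" where
  "degree_of E i = card {e \<in> E. i \<in> e}"

definition vertex_weight :: "real ^ 'v \<Rightarrow> 'v \<Rightarrow> real" where
  "vertex_weight w i = inverse (w $ i)"

definition weighted_degree :: "('v \<Rightarrow> real) \<Rightarrow> 'v set set \<Rightarrow> 'v \<Rightarrow> real" where
  "weighted_degree \<alpha> E i = \<alpha> i * real (degree_of E i)"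

definition design :: "real ^ 'v \<Rightarrow> bool" where
  "design w \<longleftrightarrow> (\<forall>i. 0 \<le> w $ i \<and> w $ i \<le> 1) \<and> (\<Sum>i\<in>UNIV. w $ i) = 1"

definition diag_matrix :: "real ^ 'n \<Rightarrow> real ^ 'n ^ 'n" where
  "diag_matrix x = (\<chi> i j. if i = j then x $ i else 0)"

definition V_matrix :: "real ^ 's ^ 'v \<Rightarrow> real ^ 'v \<Rightarrow> real ^ 's ^ 's" where
  "V_matrix Q w = transpose Q ** matrix_inv (diag_matrix w) ** Q"

definition is_pseudoinverse :: "real ^ 'n ^ 'm \<Rightarrow> real ^ 'm ^ 'n \<Rightarrow> bool" where
  "is_pseudoinverse A X \<longleftrightarrow>
     A ** X ** A = A \<and> X ** A ** X = X \<and>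
     transpose (A ** X) = A ** X \<and> transpose (X ** A) = X ** A"

text \<open>
  By Penrose's theorem, the four conditions determine \<open>X\<close> uniquely and are always satisfiable.
\<close>

definition pseudoinverse :: "real ^ 'n ^ 'm \<Rightarrow> real ^ 'm ^ 'n" where
  "pseudoinverse A = (THE X. is_pseudoinverse A X)"

definition C_matrix :: "real ^ 's ^ 'v \<Rightarrow> real ^ 'v \<Rightarrow> real ^ 's ^ 's" where
  "C_matrix Q w = pseudoinverse (V_matrix Q w)"

definition charpoly :: "real ^ 'n ^ 'n \<Rightarrow> real poly" where
  "charpoly A = det (\<chi> i j. (if i = j then [:0, 1:] else 0) - [:A $ i $ j:])"

text \<open>
  \<open>eigenvalue A j\<close> is the \<open>j\<close>-th largest eigenvalue (counting from 1, with multiplicity). Only real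
  eigenvalues are listed, which for the symmetric matrices considered here are all of them.
\<close>

definition eigenvalue :: "real ^ 'n ^ 'n \<Rightarrow> nat \<Rightarrow> real" where
  "eigenvalue A j = rev (sorted_list_of_multiset (proots (charpoly A))) ! (j - 1)"

definition Psi_neg1 :: "real ^ 's ^ 'v \<Rightarrow> real ^ 'v \<Rightarrow> real" where
  "Psi_neg1 Q w = (\<Sum>j = 1..rank Q. eigenvalue (V_matrix Q w) j)"

definition Phi_neg1 :: "real ^ 's ^ 'v \<Rightarrow> real ^ 'v \<Rightarrow> real" where
  "Phi_neg1 Q w =
     inverse (1 / real (rank Q) * (\<Sum>j = 1..rank Q. inverse (eigenvalue (C_matrix Q w) j)))"

end

theory Submission
  imports Defs
begin

text \<open>
  \<open>V_matrix Q w\<close> is symmetric and positive semidefinite, and it has the same null space as \<open>Q\<close>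
  because \<open>w > 0\<close>. In an orthogonal diagonalization \<open>P diag(d) P\<^sup>T\<close> of it, exactly \<open>rank Q\<close> entries
  of \<open>d\<close> are positive and the others vanish, so the \<open>rank Q\<close> leading eigenvalues sum to the trace.
  The pseudoinverse is diagonalized by the same \<open>P\<close>, with the positive entries of \<open>d\<close> inverted, so
  its reciprocal leading eigenvalues have the same sum. In row \<open>i\<close> of \<open>Q\<close> the squared entries count
  the comparisons involving \<open>i\<close>, which turns the trace into the sum of weighted degrees.
\<close>

section \<open>Spectral theorem for real symmetric matrices\<close>

text \<open>The quadratic form \<open>x \<bullet> f x\<close> attains its maximum on the compact
  unit sphere of \<open>S\<close>; a maximizer is an eigenvector, with the maximum as its
  eigenvalue.\<close>

lemma self_adjoint_eigenvector_exists:
  fixes f :: "'a::euclidean_space \<Rightarrow> 'a"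
  assumes f: "linear f" and adj: "\<And>x y. x \<bullet> f y = f x \<bullet> y"
    and S: "subspace S" "f ` S \<subseteq> S" "S \<noteq> {0}"
  obtains u c where "u \<in> S" "norm u = 1" "f u = c *\<^sub>R u"
proof -
  let ?K = "sphere 0 1 \<inter> S"
  have norm1: "x /\<^sub>R norm x \<in> ?K" if "x \<in> S" "x \<noteq> 0" for x
    using that S(1) by (simp add: subspace_scale)
  obtain x where "x \<in> S" "x \<noteq> 0"
    using S subspace_0 by blast
  then have "?K \<noteq> {}"
    using norm1 by blast
  moreover have "compact ?K"
    by (intro compact_Int_closed closed_subspace S compact_sphere)
  moreover have "continuous_on ?K (\<lambda>x. x \<bullet> f x)"
    by (intro continuous_intros linear_continuous_on linear_conv_bounded_linear[THEN iffD1] f)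
  ultimately obtain u where u: "u \<in> ?K" and max: "\<And>y. y \<in> ?K \<Longrightarrow> y \<bullet> f y \<le> u \<bullet> f u"
    using continuous_attains_sup[of ?K "\<lambda>x. x \<bullet> f x"] by blast
  define c where "c = u \<bullet> f u"
  define g where "g = (\<lambda>x. c * (x \<bullet> x) - x \<bullet> f x)"
  have uu: "u \<bullet> u = 1"
    using u by (simp add: norm_eq_1)
  have g_nonneg: "0 \<le> g x" if "x \<in> S" for x
  proof (cases "x = 0")
    case False
    \<comment> \<open>The quotient is invariant under scaling, so the bound on the sphere extends to
      all nonzero vectors of \<open>S\<close>.\<close>
    have "(x \<bullet> f x) / (x \<bullet> x) \<le> c"
      using max[OF norm1[OF that False]] f
      by (simp add: linear_scale c_def dot_square_norm divide_simps power2_eq_square)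
    then show ?thesis
      using False by (simp add: g_def divide_simps split: if_splits)
  qed (simp add: g_def)
  define v where "v = c *\<^sub>R u - f u"
  have "v \<in> S"
    unfolding v_def using u S by (intro subspace_diff subspace_scale) auto
  \<comment> \<open>\<open>g\<close> is nonnegative on \<open>S\<close> and vanishes at \<open>u\<close>, so its derivative at \<open>u\<close> vanishes; in the
    direction \<open>v\<close> this derivative is \<open>2 * (v \<bullet> v)\<close>.\<close>
  have expand: "g (u + t *\<^sub>R v) = 2 * t * (v \<bullet> v) + t\<^sup>2 * g v" for t
  proof -
    have "u \<bullet> f v = v \<bullet> f u"
      by (metis adj inner_commute)
    then have "g (u + t *\<^sub>R v) = 2 * t * (c * (v \<bullet> u) - v \<bullet> f u) + t\<^sup>2 * g v"
      using uu f
      by (simp add: g_def linear_add linear_scale inner_add_left inner_add_right c_def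
          power2_eq_square inner_commute[of u v] algebra_simps)
    also have "c * (v \<bullet> u) - v \<bullet> f u = v \<bullet> v"
      by (simp add: v_def inner_diff_right)
    finally show ?thesis .
  qed
  have "v \<bullet> v = 0"
  proof (rule ccontr)
    assume "v \<bullet> v \<noteq> 0"
    then have pos: "0 < v \<bullet> v"
      by simp
    \<comment> \<open>A negative \<open>t\<close> this small keeps
      \<open>2 * (v \<bullet> v) + t * g v\<close> positive, so \<open>g\<close> would be negative
      at \<open>u + t *\<^sub>R v\<close>. The summand 1 covers the case
      \<open>g v = 0\<close>.\<close>
    define t where "t = - (v \<bullet> v) / (1 + g v)"
    have gv: "0 \<le> g v"
      using g_nonneg \<open>v \<in> S\<close> by blast
    have "0 \<le> g (u + t *\<^sub>R v)"
      using u \<open>v \<in> S\<close> S by (intro g_nonneg subspace_add subspace_scale) auto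
    also have "\<dots> = t * (2 * (v \<bullet> v) + t * g v)"
      by (simp add: expand power2_eq_square algebra_simps)
    finally have "0 \<le> t * (2 * (v \<bullet> v) + t * g v)" .
    moreover have "t < 0"
      unfolding t_def using pos gv by (simp add: divide_neg_pos)
    moreover have "- t * g v \<le> v \<bullet> v"
      unfolding t_def using pos gv by (simp add: divide_simps)
    ultimately show False
      using pos by (simp add: zero_le_mult_iff)
  qed
  then have "f u = c *\<^sub>R u"
    by (simp add: v_def)
  with u show ?thesis
    by (intro that) auto
qed

text \<open>Induction on the dimension: split off a unit eigenvector \<open>u\<close>.
  Self-adjointness makes its orthogonal complement within \<open>S\<close> invariant under
  \<open>f\<close> again.\<close>

lemma self_adjoint_orthonormal_eigenbasis:
  fixes f :: "'a::euclidean_space \<Rightarrow> 'a"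
  assumes f: "linear f" and adj: "\<And>x y. x \<bullet> f y = f x \<bullet> y"
    and "subspace S" "f ` S \<subseteq> S"
  shows "\<exists>B\<subseteq>S. finite B \<and> card B = dim S \<and> pairwise orthogonal B \<and>
           (\<forall>b\<in>B. norm b = 1 \<and> (\<exists>c. f b = c *\<^sub>R b))"
  using assms(3,4)
proof (induction "dim S" arbitrary: S)
  case 0
  then show ?case
    by (intro exI[of _ "{}"]) auto
next
  case (Suc n)
  have "S \<noteq> {0}"
    using Suc.hyps(2) by auto
  then obtain u c where u: "u \<in> S" "norm u = 1" "f u = c *\<^sub>R u"
    using self_adjoint_eigenvector_exists[OF f adj] Suc.prems by metis
  define T where "T = {y \<in> S. u \<bullet> y = 0}"
  have T: "subspace T"
    using Suc.prems(1) by (auto simp: T_def subspace_def inner_add_right)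
  have fT: "f ` T \<subseteq> T"
    using Suc.prems(2) u by (auto simp: T_def adj)
  have "T = {y \<in> S. \<forall>x\<in>span {u}. orthogonal x y}"
    by (auto simp: T_def span_singleton orthogonal_def)
  then have "dim T + dim (span {u}) = dim S"
    using dim_subspace_orthogonal_to_vectors[of "span {u}" S] u Suc.prems(1)
    by (simp add: span_minimal)
  moreover have "dim (span {u}) = 1"
    using u by (auto simp: dim_span)
  ultimately have dimT: "n = dim T"
    using Suc.hyps(2) by simp
  obtain B where B: "B \<subseteq> T" "finite B" "card B = dim T" "pairwise orthogonal B"
    "\<forall>b\<in>B. norm b = 1 \<and> (\<exists>c. f b = c *\<^sub>R b)"
    using Suc.hyps(1)[OF dimT T fT] by blast
  have "u \<notin> B"
    using B(1) u(2) by (auto simp: T_def)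
  then have "card (insert u B) = dim S"
    using B Suc.hyps(2) dimT by simp
  moreover have "pairwise orthogonal (insert u B)"
    using B(1,4) by (auto simp: pairwise_insert T_def orthogonal_def inner_commute)
  ultimately show ?case
    using B u by (intro exI[of _ "insert u B"]) (auto simp: T_def)
qed

lemma diag_matrix_mult: "diag_matrix x ** diag_matrix y = diag_matrix (\<chi> i. x $ i * y $ i)"
  by (simp add: vec_eq_iff diag_matrix_def matrix_matrix_mult_def if_distrib[of "\<lambda>t. t * _"]
      cong: if_cong)

lemma transpose_diag_matrix [simp]: "transpose (diag_matrix x) = diag_matrix x"
  by (auto simp: vec_eq_iff diag_matrix_def transpose_def)

lemma diag_matrix_vector_mult: "diag_matrix x *v y = (\<chi> i. x $ i * y $ i)"
  by (simp add: vec_eq_iff diag_matrix_def matrix_vector_mult_def if_distrib[of "\<lambda>t. t * _"]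
      cong: if_cong)

text \<open>An orthonormal eigenbasis, indexed by \<open>'n\<close>, supplies the columns of
  \<open>P\<close>.\<close>

theorem symmetric_matrix_diagonalization:
  fixes A :: "real ^ 'n ^ 'n"
  assumes "transpose A = A"
  obtains P d where "orthogonal_matrix P" "A = P ** diag_matrix d ** transpose P"
proof -
  have adj: "x \<bullet> (A *v y) = (A *v x) \<bullet> y" for x y
    by (metis assms dot_lmul_matrix vector_transpose_matrix)
  obtain B where B: "finite B" "card B = CARD('n)" "pairwise orthogonal B"
    "\<forall>b\<in>B. norm b = 1 \<and> (\<exists>c. A *v b = c *\<^sub>R b)"
    using self_adjoint_orthonormal_eigenbasis[OF matrix_vector_mul_linear[of A] adj, of UNIV]
    by auto
  obtain b where b: "bij_betw b (UNIV :: 'n set) B"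
    using B(1,2) by (metis finite bij_betw_iff_card)
  then have bB: "b i \<in> B" for i
    by (auto simp: bij_betw_def)
  have "\<forall>i. \<exists>c. A *v b i = c *\<^sub>R b i"
    using B(4) bB by blast
  then obtain d where d: "\<And>i. A *v b i = d i *\<^sub>R b i"
    by (auto dest!: choice)
  define P :: "real ^ 'n ^ 'n" where "P = (\<chi> i j. b j $ i)"
  have col: "column j P = b j" for j
    by (simp add: P_def column_def)
  have "orthogonal (b i) (b j)" if "i \<noteq> j" for i j
  proof (rule pairwiseD[OF B(3) bB bB])
    show "b i \<noteq> b j"
      using that inj_eq[OF bij_betw_imp_inj_on[OF b]] by blast
  qed
  moreover have "norm (b i) = 1" for i
    using B(4) bB by blast
  ultimately have P: "orthogonal_matrix P"
    by (simp add: orthogonal_matrix_orthonormal_columns col)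
  have "A ** P = P ** diag_matrix (\<chi> i. d i)"
  proof -
    have "(A ** P) $ i $ j = (A *v b j) $ i" for i j
      by (simp add: matrix_matrix_mult_def matrix_vector_mult_def P_def)
    then show ?thesis
      by (simp add: vec_eq_iff d)
         (simp add: matrix_matrix_mult_def diag_matrix_def P_def if_distrib mult.commute cong: if_cong)
  qed
  then have "A = P ** diag_matrix (\<chi> i. d i) ** transpose P"
    using P by (metis matrix_mul_assoc matrix_mul_rid orthogonal_matrix_def)
  with P show ?thesis
    by (rule that)
qed

text \<open>The scalar matrix \<open>X\<close> commutes with every matrix, so conjugation by
  \<open>P\<close> can be pulled out of the characteristic matrix and disappears in the
  determinant.\<close>

lemma charpoly_orthogonal_diag:
  fixes P :: "real ^ 'n ^ 'n"
  assumes "orthogonal_matrix P"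
  shows "charpoly (P ** diag_matrix d ** transpose P) = (\<Prod>i\<in>UNIV. [:- d $ i, 1:])"
proof -
  \<comment> \<open>\<open>C\<close> embeds real matrices as matrices of constant polynomials. It is
    multiplicative and preserves the identity, so the orthogonality of \<open>P\<close> carries
    over.\<close>
  define C :: "real ^ 'n ^ 'n \<Rightarrow> real poly ^ 'n ^ 'n" where "C = (\<lambda>M. \<chi> i j. [:M $ i $ j:])"
  have sum_const: "(\<Sum>k\<in>S. [:h k:]) = [:sum h S:]" for h :: "'n \<Rightarrow> real" and S
    by (induction S rule: infinite_finite_induct) auto
  have C_mult: "C (M ** N) = C M ** C N" for M N
    by (simp add: C_def vec_eq_iff matrix_matrix_mult_def sum_const mult.commute)
  have C_1: "C (mat 1) = mat 1"
    by (auto simp: C_def vec_eq_iff mat_def)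
  define X :: "real poly ^ 'n ^ 'n" where "X = mat [:0, 1:]"
  have X_comm: "X ** M = M ** X" for M
    by (simp add: X_def vec_eq_iff matrix_matrix_mult_def mat_def if_distrib[of "\<lambda>x. x * _"]
        if_distrib[of "\<lambda>x. _ * x"] mult.commute cong: if_cong)
  have sub_ldistrib: "K ** (M - N) = K ** M - K ** N"
    and sub_rdistrib: "(M - N) ** K = M ** K - N ** K" for K M N :: "real poly ^ 'n ^ 'n"
    by (simp_all add: vec_eq_iff matrix_matrix_mult_def algebra_simps sum_subtractf)
  have PP: "C P ** C (transpose P) = mat 1"
    using assms by (simp add: C_mult[symmetric] orthogonal_matrix_def C_1)
  have "charpoly (P ** diag_matrix d ** transpose P)
      = det (X - C (P ** diag_matrix d ** transpose P))"
    unfolding charpoly_def by (rule arg_cong[of _ _ det]) (auto simp: X_def C_def vec_eq_iff mat_def)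
  also have "X - C (P ** diag_matrix d ** transpose P)
      = C P ** (X - C (diag_matrix d)) ** C (transpose P)"
  proof -
    have "C P ** X ** C (transpose P) = X"
      by (simp add: X_comm[symmetric] PP flip: matrix_mul_assoc)
    then show ?thesis
      by (simp add: C_mult sub_ldistrib sub_rdistrib matrix_mul_assoc)
  qed
  also have "det \<dots> = det (C P ** C (transpose P)) * det (X - C (diag_matrix d))"
    by (simp add: det_mul mult_ac)
  also have "\<dots> = (\<Prod>i\<in>UNIV. [:- d $ i, 1:])"
    by (simp add: PP, subst det_diagonal) (auto simp: X_def C_def mat_def diag_matrix_def)
  finally show ?thesis .
qed

lemma proots_charpoly_orthogonal_diag:
  fixes P :: "real ^ 'n ^ 'n"
  assumes "orthogonal_matrix P"
  shows "proots (charpoly (P ** diag_matrix d ** transpose P)) = image_mset (($) d) (mset_set UNIV)"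
proof -
  have "proots [:- a, 1:] = {#a#}" for a :: real
    using proots_linear_factor[of "- a"] by simp
  then show ?thesis
    by (simp add: charpoly_orthogonal_diag[OF assms] proots_prod sum_unfold_sum_mset)
qed

section \<open>Moore-Penrose pseudoinverse\<close>

text \<open>\<open>A ** X\<close> and \<open>A ** Y\<close> are orthogonal projections onto the
  range of \<open>A\<close>, hence equal; likewise \<open>X ** A\<close> and
  \<open>Y ** A\<close>.\<close>

lemma is_pseudoinverse_unique:
  assumes X: "is_pseudoinverse A X" and Y: "is_pseudoinverse A Y"
  shows "X = Y"
proof -
  have 1: "A ** X = A ** Y"
  proof -
    have "A ** X = transpose (A ** X)"
      using X by (simp add: is_pseudoinverse_def)
    \<comment> \<open>Insert \<open>A = A ** Y ** A\<close>; transposing then swaps the two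
      symmetric factors.\<close>
    also have "\<dots> = transpose ((A ** Y) ** (A ** X))"
      using Y by (metis is_pseudoinverse_def matrix_mul_assoc)
    also have "\<dots> = (A ** X) ** (A ** Y)"
      using X Y by (simp add: is_pseudoinverse_def matrix_transpose_mul[of "A ** Y" "A ** X"])
    also have "\<dots> = A ** Y"
      using X by (metis is_pseudoinverse_def matrix_mul_assoc)
    finally show ?thesis .
  qed
  have 2: "X ** A = Y ** A"
  proof -
    have "X ** A = transpose (X ** A)"
      using X by (simp add: is_pseudoinverse_def)
    also have "\<dots> = transpose ((X ** A) ** (Y ** A))"
      using Y by (metis is_pseudoinverse_def matrix_mul_assoc)
    also have "\<dots> = (Y ** A) ** (X ** A)"
      using X Y by (simp add: is_pseudoinverse_def matrix_transpose_mul[of "X ** A" "Y ** A"])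
    also have "\<dots> = Y ** A"
      using X by (metis is_pseudoinverse_def matrix_mul_assoc)
    finally show ?thesis .
  qed
  \<comment> \<open>The chain is X = XAX = YAX = YAY = Y.\<close>
  show ?thesis
    using X Y 1 2 by (metis is_pseudoinverse_def matrix_mul_assoc)
qed

lemma pseudoinverse_eq: "is_pseudoinverse A X \<Longrightarrow> pseudoinverse A = X"
  unfolding pseudoinverse_def using is_pseudoinverse_unique by blast

text \<open>A zero entry of \<open>d\<close> stays zero, since \<open>inverse 0 = 0\<close>.\<close>

lemma pseudoinverse_orthogonal_diag:
  fixes P :: "real ^ 'n ^ 'n"
  assumes "orthogonal_matrix P"
  shows "pseudoinverse (P ** diag_matrix d ** transpose P)
    = P ** diag_matrix (\<chi> i. inverse (d $ i)) ** transpose P"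
proof (rule pseudoinverse_eq)
  \<comment> \<open>The inner factors \<open>transpose P ** P\<close> cancel, which reduces the
    Penrose conditions to identities between diagonal entries.\<close>
  have conj_mult: "(P ** M ** transpose P) ** (P ** N ** transpose P)
      = P ** (M ** N) ** transpose P" for M N
    using assms by (metis matrix_mul_assoc matrix_mul_rid orthogonal_matrix_def)
  have idem: "x * inverse x * x = x" "inverse x * x * inverse x = inverse x" for x :: real
    by (cases "x = 0"; simp)+
  show "is_pseudoinverse (P ** diag_matrix d ** transpose P)
      (P ** diag_matrix (\<chi> i. inverse (d $ i)) ** transpose P)"
    unfolding is_pseudoinverse_def conj_mult diag_matrix_mult
    by (simp add: idem matrix_transpose_mul matrix_mul_assoc vec_lambda_eta)
qed

section \<open>Sums of leading eigenvalues\<close>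

text \<open>In a descending list of nonnegative numbers the zeros form a final segment.\<close>

lemma take_nonzero_descending:
  fixes xs :: "real list"
  assumes "sorted_wrt (\<ge>) xs" "\<forall>x\<in>set xs. 0 \<le> x"
  shows "take (length (filter (\<lambda>x. x \<noteq> 0) xs)) xs = filter (\<lambda>x. x \<noteq> 0) xs"
  using assms
proof (induction xs)
  case (Cons a xs)
  show ?case
  proof (cases "a = 0")
    case True
    then have "filter (\<lambda>x. x \<noteq> 0) xs = []"
      using Cons.prems by (fastforce simp: filter_empty_conv)
    with True show ?thesis
      by simp
  qed (use Cons in auto)
qed auto

text \<open>Stated for general \<open>f\<close> to serve both criteria: the identity for
  \<open>Psi_neg1\<close> and \<open>inverse\<close> for \<open>Phi_neg1\<close>. By
  \<open>f 0 = 0\<close>, the omitted zero eigenvalues contribute nothing.\<close>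

lemma sum_eigenvalue_orthogonal_diag:
  fixes P :: "real ^ 'n ^ 'n" and f :: "real \<Rightarrow> real"
  assumes "orthogonal_matrix P" "\<And>i. 0 \<le> d $ i" and r: "r = card {i. d $ i \<noteq> 0}" and "f 0 = 0"
  shows "(\<Sum>j=1..r. f (eigenvalue (P ** diag_matrix d ** transpose P) j)) = (\<Sum>i\<in>UNIV. f (d $ i))"
proof -
  define M where "M = image_mset (($) d) (mset_set UNIV)"
  define xs where "xs = rev (sorted_list_of_multiset M)"
  have mset: "mset xs = M"
    by (simp add: xs_def)
  have "sorted_wrt (\<ge>) xs"
    by (simp add: xs_def sorted_wrt_rev)
  moreover have "\<forall>x\<in>set xs. 0 \<le> x"
    using assms(2) by (simp add: mset M_def flip: set_mset_mset)
  ultimately have take: "take (length (filter (\<lambda>x. x \<noteq> 0) xs)) xs = filter (\<lambda>x. x \<noteq> 0) xs"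
    by (rule take_nonzero_descending)
  have len: "length (filter (\<lambda>x. x \<noteq> 0) xs) = r"
    using arg_cong[OF mset, of "\<lambda>M. size (filter_mset (\<lambda>x. x \<noteq> 0) M)"]
    by (simp add: r M_def filter_mset_image_mset flip: size_mset)
  have "r \<le> length xs"
    using len length_filter_le by metis
  have "(\<Sum>j=1..r. f (eigenvalue (P ** diag_matrix d ** transpose P) j)) = (\<Sum>j<r. f (xs ! j))"
    \<comment> \<open>Eigenvalues are counted from 1, list positions from 0.\<close>
    by (rule sum.reindex_bij_witness[of _ Suc "\<lambda>j. j - 1"])
       (auto simp: eigenvalue_def proots_charpoly_orthogonal_diag[OF assms(1)] M_def xs_def)
  also have "\<dots> = sum_list (map f (take r xs))"
    using \<open>r \<le> length xs\<close> by (simp add: sum_list_sum_nth atLeast0LessThan)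
  also have "\<dots> = sum_list (map f (filter (\<lambda>x. x \<noteq> 0) xs))"
    using take len by simp
  also have "\<dots> = sum_list (map f xs)"
    by (rule sum_list_map_filter) (use assms(4) in auto)
  also have "\<dots> = (\<Sum>x\<in>#M. f x)"
    by (simp flip: mset mset_map add: sum_mset_sum_list)
  also have "\<dots> = (\<Sum>i\<in>UNIV. f (d $ i))"
    by (simp add: M_def sum_unfold_sum_mset image_mset.compositionality o_def)
  finally show ?thesis .
qed

section \<open>Ranks and Gram matrices\<close>

text \<open>The row space of \<open>A\<close> meets the null space of \<open>A\<close> only in 0, so
  \<open>B\<close> is injective on it and preserves its dimension, which is
  \<open>rank A\<close>.\<close>

lemma rank_le_if_nullspace_subset:
  fixes A :: "real ^ 'n ^ 'm" and B :: "real ^ 'n ^ 'k"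
  assumes "\<And>x. B *v x = 0 \<Longrightarrow> A *v x = 0"
  shows "rank A \<le> rank B"
proof -
  have "inj_on ((*v) B) (span (rows A))"
  proof (rule inj_onI)
    fix x y
    assume xy: "x \<in> span (rows A)" "y \<in> span (rows A)" "B *v x = B *v y"
    then have "A *v (x - y) = 0"
      by (intro assms) (simp add: matrix_vector_mult_diff_distrib)
    then show "x = y"
      using xy nullspace_inter_rowspace[of A "x - y"] span_diff by fastforce
  qed
  then have "rank A = dim ((*v) B ` rows A)"
    by (simp add: row_rank_def dim_image_eq)
  also have "\<dots> \<le> rank B"
    unfolding rank_dim_range by (rule dim_subset) auto
  finally show ?thesis .
qed

lemma rank_diag_matrix: "rank (diag_matrix d :: real ^ 'n ^ 'n) = card {i. d $ i \<noteq> 0}"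
proof -
  have "range ((*v) (diag_matrix d)) = {x. \<forall>i. i \<notin> {i. d $ i \<noteq> 0} \<longrightarrow> x $ i = 0}"
  proof (intro equalityI subsetI)
    fix x :: "real ^ 'n"
    assume "x \<in> {x. \<forall>i. i \<notin> {i. d $ i \<noteq> 0} \<longrightarrow> x $ i = 0}"
    \<comment> \<open>Where \<open>d $ i = 0\<close> the quotient is 0 by convention, and
      \<open>x $ i\<close> vanishes there as well.\<close>
    then have "x = diag_matrix d *v (\<chi> i. x $ i / d $ i)"
      by (auto simp: diag_matrix_vector_mult vec_eq_iff)
    then show "x \<in> range ((*v) (diag_matrix d))"
      by blast
  qed (auto simp: diag_matrix_vector_mult)
  then show ?thesis
    by (simp only: rank_dim_range dim_substandard_cart flip: dim_vec_eq)
qed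

lemma matrix_inv_diag_matrix:
  fixes w :: "real ^ 'n"
  assumes "\<forall>i. w $ i \<noteq> 0"
  shows "matrix_inv (diag_matrix w) = diag_matrix (\<chi> i. inverse (w $ i))"
proof -
  have 1: "diag_matrix (\<chi> i. 1) = (mat 1 :: real ^ 'n ^ 'n)"
    by (simp add: diag_matrix_def mat_def cong: if_cong)
  \<comment> \<open>\<open>matrix_inv\<close> is a choice among two-sided inverses; exhibiting one
    shows that the chosen matrix is an inverse too.\<close>
  have "diag_matrix w ** matrix_inv (diag_matrix w) = mat 1 \<and>
        matrix_inv (diag_matrix w) ** diag_matrix w = mat 1"
    unfolding matrix_inv_def
    by (rule someI[of _ "diag_matrix (\<chi> i. inverse (w $ i))"])
       (use assms in \<open>simp add: diag_matrix_mult 1\<close>)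
  moreover have "diag_matrix (\<chi> i. inverse (w $ i)) ** diag_matrix w = mat 1"
    using assms by (simp add: diag_matrix_mult 1)
  ultimately show ?thesis
    by (metis matrix_mul_assoc matrix_mul_lid matrix_mul_rid)
qed

lemma V_matrix_eq:
  assumes "\<forall>i. 0 < w $ i"
  shows "V_matrix Q w = transpose Q ** diag_matrix (\<chi> i. inverse (w $ i)) ** Q"
proof -
  have "\<forall>i. w $ i \<noteq> 0"
    using assms by (metis less_irrefl)
  then show ?thesis
    by (simp add: V_matrix_def matrix_inv_diag_matrix)
qed

lemma inner_vector_matrix_mult:
  fixes A :: "real ^ 'n ^ 'm"
  shows "x \<bullet> (y v* A) = (A *v x) \<bullet> y"
  by (metis dot_lmul_matrix inner_commute)

text \<open>This form as a weighted sum of squares yields both the semidefiniteness of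
  \<open>V_matrix Q w\<close> and its null space.\<close>

lemma inner_V_matrix:
  fixes w :: "real ^ 'v"
  assumes "\<forall>i. 0 < w $ i"
  shows "x \<bullet> (V_matrix Q w *v x) = (\<Sum>i\<in>UNIV. inverse (w $ i) * ((Q *v x) $ i)\<^sup>2)"
proof -
  have "x \<bullet> (V_matrix Q w *v x) = (Q *v x) \<bullet> (diag_matrix (\<chi> i. inverse (w $ i)) *v (Q *v x))"
    by (simp add: V_matrix_eq[OF assms] inner_vector_matrix_mult flip: matrix_vector_mul_assoc)
  then show ?thesis
    by (simp add: diag_matrix_vector_mult inner_vec_def power2_eq_square mult_ac)
qed

lemma rank_V_matrix:
  assumes "\<forall>i. 0 < w $ i"
  shows "rank (V_matrix Q w) = rank Q"
proof (rule antisym)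
  show "rank (V_matrix Q w) \<le> rank Q"
    unfolding V_matrix_def by (rule rank_mul_le_right)
  show "rank Q \<le> rank (V_matrix Q w)"
  proof (rule rank_le_if_nullspace_subset)
    fix x
    assume "V_matrix Q w *v x = 0"
    then have "(\<Sum>i\<in>UNIV. inverse (w $ i) * ((Q *v x) $ i)\<^sup>2) = 0"
      using inner_V_matrix[OF assms, of x Q] by simp
    then have "\<forall>i. inverse (w $ i) * ((Q *v x) $ i)\<^sup>2 = 0"
      using assms by (subst (asm) sum_nonneg_eq_0_iff) (auto simp: less_imp_le)
    then show "Q *v x = 0"
      using assms by (auto simp: vec_eq_iff less_imp_neq[symmetric] dest!: spec)
  qed
qed

lemma V_matrix_diagonalization:
  fixes Q :: "real ^ 's ^ 'v"
  assumes w: "\<forall>i. 0 < w $ i"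
  obtains P d where "orthogonal_matrix P" "V_matrix Q w = P ** diag_matrix d ** transpose P"
    "\<And>i. 0 \<le> d $ i" "rank Q = card {i. d $ i \<noteq> 0}"
proof -
  have "transpose (V_matrix Q w) = V_matrix Q w"
    by (simp add: V_matrix_eq[OF w] matrix_transpose_mul matrix_mul_assoc)
  then obtain P d where P: "orthogonal_matrix P"
    and V: "V_matrix Q w = P ** diag_matrix d ** transpose P"
    using symmetric_matrix_diagonalization by blast
  have D: "diag_matrix d = transpose P ** V_matrix Q w ** P"
    using P unfolding V orthogonal_matrix_def
    by (metis matrix_mul_assoc matrix_mul_lid matrix_mul_rid)
  have "0 \<le> d $ i" for i
  proof -
    \<comment> \<open>Each \<open>d $ i\<close> is the quadratic form of \<open>V_matrix Q w\<close>
      at column \<open>i\<close> of \<open>P\<close>.\<close>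
    have "d $ i = axis i 1 \<bullet> (diag_matrix d *v axis i 1)"
      by (simp add: diag_matrix_vector_mult inner_axis')
    also have "\<dots> = (P *v axis i 1) \<bullet> (V_matrix Q w *v (P *v axis i 1))"
      by (simp add: D inner_vector_matrix_mult flip: matrix_vector_mul_assoc)
    also have "\<dots> \<ge> 0"
      unfolding inner_V_matrix[OF w] using w
      by (intro sum_nonneg mult_nonneg_nonneg) (auto intro: less_imp_le)
    finally show ?thesis .
  qed
  moreover have "rank Q = card {i. d $ i \<noteq> 0}"
  proof -
    \<comment> \<open>Each of the two matrices is a product containing the other as a factor, so
      neither rank exceeds the other.\<close>
    have "rank (diag_matrix d) \<le> rank (V_matrix Q w)"
      unfolding D by (metis order_trans rank_mul_le_left rank_mul_le_right)
    moreover have "rank (V_matrix Q w) \<le> rank (diag_matrix d)"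
      unfolding V by (metis order_trans rank_mul_le_left rank_mul_le_right)
    ultimately show ?thesis
      using rank_V_matrix[OF w] rank_diag_matrix by (metis order_antisym)
  qed
  ultimately show ?thesis
    using that P V by blast
qed

lemma trace_orthogonal_diag:
  assumes "orthogonal_matrix P"
  shows "trace (P ** diag_matrix d ** transpose P) = (\<Sum>i\<in>UNIV. d $ i)"
proof -
  have "trace (P ** diag_matrix d ** transpose P) = trace (transpose P ** P ** diag_matrix d)"
    by (simp add: trace_mul_sym[of "P ** diag_matrix d"] matrix_mul_assoc)
  also have "\<dots> = trace (diag_matrix d)"
    using assms by (simp add: orthogonal_matrix_def)
  finally show ?thesis
    by (simp add: trace_def diag_matrix_def)
qed

section \<open>The comparison graph\<close>

lemma comparison_support:
  "j \<noteq> i \<Longrightarrow> {l. comparison j i $ l \<noteq> 0} = {j, i}"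
  by (auto simp: comparison_def axis_def)

lemma comparison_self [simp]: "comparison i i = 0"
  by (simp add: comparison_def)

text \<open>Identifying edges with column supports lets the injectivity condition turn edge counts
  into column counts.\<close>

lemma comparison_graph_eq_supports:
  assumes "pairwise_comparisons Q"
  shows "comparison_graph Q = range (\<lambda>k. {i. column k Q $ i \<noteq> 0})"
proof (intro equalityI subsetI)
  fix e
  assume "e \<in> comparison_graph Q"
  then obtain j i k where e: "e = {j, i}" and k: "column k Q = comparison j i"
    by (auto simp: comparison_graph_def)
  \<comment> \<open>\<open>comparison_graph\<close> does not itself demand
    \<open>j \<noteq> i\<close>; a loop would come from a zero column.\<close>
  have "column k Q \<noteq> 0"
    using assms comparison_support unfolding pairwise_comparisons_def
    by (metis (mono_tags, lifting) empty_Collect_eq insert_not_empty zero_index)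
  then have "j \<noteq> i"
    using k by auto
  then show "e \<in> range (\<lambda>k. {i. column k Q $ i \<noteq> 0})"
    using e comparison_support[of j i] by (intro range_eqI[of _ _ k]) (simp add: k)
next
  fix e
  assume "e \<in> range (\<lambda>k. {i. column k Q $ i \<noteq> 0})"
  then obtain k where e: "e = {i. column k Q $ i \<noteq> 0}"
    by auto
  obtain i j where "i \<noteq> j" "column k Q = comparison j i"
    using assms unfolding pairwise_comparisons_def by blast
  then show "e \<in> comparison_graph Q"
    using e comparison_support[of j i] by (auto simp: comparison_graph_def)
qed

text \<open>Entries of \<open>Q\<close> are 0, 1 or -1, so a squared entry indicates whether column
  \<open>k\<close> is an edge at \<open>i\<close>, and distinct columns give distinct edges.\<close>

lemma degree_comparison_graph:
  fixes Q :: "real ^ 's ^ 'v"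
  assumes Q: "pairwise_comparisons Q"
  shows "real (degree_of (comparison_graph Q) i) = (\<Sum>k\<in>UNIV. (Q $ i $ k)\<^sup>2)"
proof -
  let ?e = "\<lambda>k. {i. column k Q $ i \<noteq> 0}"
  have "{e \<in> comparison_graph Q. i \<in> e} = ?e ` {k. Q $ i $ k \<noteq> 0}"
    unfolding comparison_graph_eq_supports[OF Q] by (auto simp: column_def)
  moreover have "inj_on ?e {k. Q $ i $ k \<noteq> 0}"
    using Q inj_on_subset[OF _ subset_UNIV] unfolding pairwise_comparisons_def by blast
  ultimately have "degree_of (comparison_graph Q) i = card {k. Q $ i $ k \<noteq> 0}"
    by (simp add: degree_of_def card_image)
  moreover have "(Q $ i $ k)\<^sup>2 = (if Q $ i $ k \<noteq> 0 then 1 else 0)" for k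
  proof -
    obtain a b where "a \<noteq> b" "column k Q = comparison b a"
      using Q unfolding pairwise_comparisons_def by blast
    then have "Q $ i $ k = comparison b a $ i"
      by (simp add: column_def vec_eq_iff)
    then show ?thesis
      using \<open>a \<noteq> b\<close> by (auto simp: comparison_def axis_def)
  qed
  ultimately show ?thesis
    by (simp add: sum.If_cases)
qed

lemma trace_V_matrix:
  fixes Q :: "real ^ 's ^ 'v"
  assumes "pairwise_comparisons Q" "\<forall>i. 0 < w $ i"
  shows "trace (V_matrix Q w)
    = (\<Sum>i\<in>UNIV. inverse (w $ i) * real (degree_of (comparison_graph Q) i))"
proof -
  have "trace (V_matrix Q w) = (\<Sum>k\<in>UNIV. \<Sum>i\<in>UNIV. inverse (w $ i) * (Q $ i $ k)\<^sup>2)"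
    unfolding V_matrix_eq[OF assms(2)] trace_def
    by (simp add: matrix_matrix_mult_def transpose_def diag_matrix_def power2_eq_square
        if_distrib mult_ac cong: if_cong)
  also have "\<dots> = (\<Sum>i\<in>UNIV. inverse (w $ i) * (\<Sum>k\<in>UNIV. (Q $ i $ k)\<^sup>2))"
    by (subst sum.swap) (simp add: sum_distrib_left)
  finally show ?thesis
    by (simp add: degree_comparison_graph[OF assms(1)])
qed

theorem proposition3:
  fixes Q :: "real ^ 's ^ 'v" and w :: "real ^ 'v" and r :: nat
  assumes "pairwise_comparisons Q"
    and "r = rank Q"
    and "design w"
    and "\<forall>i. 0 < w $ i"
  shows "Psi_neg1 Q w = (\<Sum>i\<in>UNIV. inverse (w $ i) * real (degree_of (comparison_graph Q) i))
    \<and> (\<Sum>i\<in>UNIV. inverse (w $ i) * real (degree_of (comparison_graph Q) i))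
        = (\<Sum>i\<in>UNIV. weighted_degree (vertex_weight w) (comparison_graph Q) i)
    \<and> Phi_neg1 Q w
        = real r * inverse (\<Sum>i\<in>UNIV. inverse (w $ i) * real (degree_of (comparison_graph Q) i))"
proof -
  obtain P d where P: "orthogonal_matrix P"
    and V: "V_matrix Q w = P ** diag_matrix d ** transpose P"
    and d: "\<And>i. 0 \<le> d $ i" "rank Q = card {i. d $ i \<noteq> 0}"
    by (rule V_matrix_diagonalization[OF assms(4), of Q]) (rule that)
  have C: "C_matrix Q w = P ** diag_matrix (\<chi> i. inverse (d $ i)) ** transpose P"
    by (simp add: C_matrix_def V pseudoinverse_orthogonal_diag[OF P])
  have tr: "(\<Sum>i\<in>UNIV. d $ i)
      = (\<Sum>i\<in>UNIV. inverse (w $ i) * real (degree_of (comparison_graph Q) i))"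
    using trace_V_matrix[OF assms(1,4)] by (simp add: V trace_orthogonal_diag[OF P])
  have "Psi_neg1 Q w = (\<Sum>i\<in>UNIV. d $ i)"
    using sum_eigenvalue_orthogonal_diag[OF P d, of "\<lambda>x. x"] by (simp add: Psi_neg1_def V)
  \<comment> \<open>Inverting preserves which entries of \<open>d\<close> are nonzero, so the same
    number of leading eigenvalues is summed; inverting twice returns \<open>d\<close>, zeros
    included.\<close>
  moreover have "(\<Sum>j=1..rank Q. inverse (eigenvalue (C_matrix Q w) j)) = (\<Sum>i\<in>UNIV. d $ i)"
    unfolding C by (subst sum_eigenvalue_orthogonal_diag[OF P]) (use d in auto)
  ultimately show ?thesis
    by (simp add: tr Phi_neg1_def assms(2) weighted_degree_def vertex_weight_def field_simps)
qed

end
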